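(* Let $\mathcal H$ be a real Hilbert space with norm $\|\cdot\|$. Let $\alpha,\gamma,\rho\in\left]0,+\infty\right[$, let $q\in\left]1,+\infty\right[$, and set $q^*=q/(q-1)$. Define $\varphi\colon\mathcal H\to\mathbb R$ by $$\varphi(x)=\begin{cases}\alpha-\dfrac{\rho^{q^*}}{q^*}+\rho\|x\|,&\text{if }\|x\|>\rho^{q^*/q};\\[2mm] \alpha+\dfrac{\|x\|^q}{q},&\text{if }\|x\|\leq\rho^{q^*/q}.\end{cases}$$ Let $\sigma\in\mathbb R$ and $x\in\mathcal H$. Then $$\widetilde\varphi(\sigma,x)=\begin{cases}\Big(\alpha-\dfrac{\rho^{q^*}}{q^*}\Big)\sigma+\rho\|x\|,&\text{if }\sigma>0\text{ and }\|x\|>\sigma\rho^{q^*/q};\\[2mm] \alpha\sigma+\dfrac{\|x\|^q}{q\sigma^{q-1}},&\text{if }\sigma>0\text{ and }\|x\|\leq\sigma\rho^{q^*/q};\\[2mm] \rho\|x\|,&\text{if }\sigma=0;\\ +\infty,&\text{if }\sigma<0.\end{cases}$$ In addition, the following hold: (i) Suppose that $\|x\|\leq\gamma\rho$ and $\|x\|^{q^*}\leq\gamma^{q^*}q^*(\alpha-\sigma/\gamma)$. Then $\operatorname{prox}_{\gamma\widetilde\varphi}(\sigma,x)=(0,0)$. (ii) Suppose that $\sigma\leq\gamma(\alpha-\rho^{q^*}/q^* )$ and $\|x\|>\gamma\rho$. Then $\operatorname{prox}_{\gamma\widetilde\varphi}(\sigma,x)=\Big(0,\Big(1-\dfrac{\gamma\rho}{\|x\|}\Big)x\Big)$.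 (iii) Suppose that $\sigma>\gamma(\alpha-\rho^{q^*}/q^* )$ and $\|x\|\geq\gamma\rho^{q^*-1}(\sigma/\gamma+\rho^{2-q^*}+\rho^{q^*}/q^*-\alpha)$. Then $$\operatorname{prox}_{\gamma\widetilde\varphi}(\sigma,x)=\Big(\sigma+\gamma\Big(\frac{\rho^{q^*}}{q^*}-\alpha\Big),\Big(1-\frac{\gamma\rho}{\|x\|}\Big)x\Big).$$ (iv) Suppose that $\|x\|^{q^*}>q^*\gamma^{q^*}(\alpha-\sigma/\gamma)$ and $\|x\|<\gamma\rho^{q^*-1}(\sigma/\gamma+\rho^{2-q^*}+\rho^{q^*}/q^*-\alpha)$. If $x\neq 0$, let $t$ be the unique solution in $\left]0,+\infty\right[$ to the equation $$\gamma t^{2q^*-1}+q^*(\sigma-\gamma\alpha)t^{q^*-1}+\gamma q^*t-q^*\|x\|=0$$ (in particular, such a solution exists and is unique). Set $p=tx/\|x\|$ if $x\neq 0$, and set $t=0$ and $p=0$ if $x=0$. Then $$\operatorname{prox}_{\gamma\widetilde\varphi}(\sigma,x)=\begin{cases}\big(\sigma+\gamma(t^{q^*}/q^*-\alpha),\,x-\gamma p\big),&\text{if }q^*\gamma^{q^*-1}\sigma+\|x\|^{q^*}>q^*\gamma^{q^*}\alpha;\\ (0,0),&\text{if }q^*\gamma^{q^*-1}\sigma+\|x\|^{q^*}\leq q^*\gamma^{q^*}\alpha.\end{cases}$$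
   Context: For a real Hilbert space $\mathcal H$, $\Gamma_0(\mathcal H)$ is the class of proper lower semicontinuous convex functions from $\mathcal H$ to $\left]-\infty,+\infty\right]$. For $\varphi\in\Gamma_0(\mathcal H)$: the recession function is $(\operatorname{rec}\varphi)(x)=\sup_{y\in\operatorname{dom}\varphi}(\varphi(x+y)-\varphi(y))$; the perspective of $\varphi$ is $\widetilde\varphi\colon\mathbb R\times\mathcal H\to\left]-\infty,+\infty\right]$ defined by $\widetilde\varphi(\sigma,x)=\sigma\varphi(x/\sigma)$ if $\sigma>0$, $\widetilde\varphi(0,x)=(\operatorname{rec}\varphi)(x)$, and $\widetilde\varphi(\sigma,x)=+\infty$ if $\sigma<0$. The space $\mathbb R\oplus\mathcal H$ is the Hilbert direct sum, with $\langle(\sigma,x)\mid(\tau,y)\rangle=\sigma\tau+\langle x\mid y\rangle$. For $f\in\Gamma_0(\mathcal K)$ with $\mathcal K$ a real Hilbert space, $\operatorname{prox}_f(z)$ is the unique minimizer over $y\in\mathcal K$ of $f(y)+\frac12\|z-y\|^2$; $\operatorname{prox}_{\gamma\widetilde\varphi}$ is taken in $\mathbb R\oplus\mathcal H$. *)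

theory Defs
  imports "HOL-Analysis.Analysis"
begin

text \<open>A real Hilbert space is a type of sort \<open>{real_inner, complete_space}\<close>. The Hilbert direct sum
  of the reals and such a space is the product type, whose library inner product is
  \<open>inner (s, x) (t, y) = s * t + inner x y\<close>. Functions with values in \<open>]-\<infinity>, +\<infinity>]\<close> are functions
  into \<open>ereal\<close>; the definitions below are total and are meant for proper lower semicontinuous
  convex functions.\<close>

definition edom :: "('a \<Rightarrow> ereal) \<Rightarrow> 'a set"
  where "edom f = {x. f x < \<infinity>}"

definition recession :: "('a::real_vector \<Rightarrow> ereal) \<Rightarrow> 'a \<Rightarrow> ereal"
  where "recession f x = (SUP y\<in>edom f. f (x + y) - f y)"

definition perspective :: "('a::real_vector \<Rightarrow> ereal) \<Rightarrow> real \<times> 'a \<Rightarrow> ereal"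
  where "perspective f = (\<lambda>(s, x).
    if s > 0 then ereal s * f (x /\<^sub>R s)
    else if s = 0 then recession f x
    else \<infinity>)"

text \<open>The value of \<open>prox\<close> is unspecified unless there is exactly one minimizer.\<close>

definition prox :: "('a::real_normed_vector \<Rightarrow> ereal) \<Rightarrow> 'a \<Rightarrow> 'a"
  where "prox f z =
    (THE p. is_arg_min (\<lambda>y. f y + ereal (1 / 2 * (norm (z - y))\<^sup>2)) (\<lambda>_. True) p)"

end

(* The conjugate of \<phi> is |u|^q* / q* - \<alpha> on the ball |u| \<le> \<rho> and +\<infinity> elsewhere, and the perspective of \<phi>
   is the support function of C = {(\<mu>, u). |u| \<le> \<rho>, \<mu> + |u|^q* / q* \<le> \<alpha>}. Hence p is the proximal
   point of z as soon as w = (z - p) / \<gamma> lies in C and the perspective at p equals <p, w>; in each case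
   this can be checked for the given formula with Young's inequality and its equality case. *)

theory Submission
  imports Defs
begin

section \<open>A subgradient criterion for proximal points\<close>

text \<open>Expanding the square turns the subgradient inequality into quadratic growth: the
  objective at \<open>y\<close> exceeds its value at \<open>p\<close> by at least half of
  \<open>(norm (y - p))\<^sup>2\<close>. This makes \<open>p\<close> a minimizer and excludes any
  other, so the definite description in \<open>prox\<close> denotes \<open>p\<close>.\<close>

lemma prox_eqI:
  fixes f :: "'a::real_inner \<Rightarrow> ereal"
  assumes fp: "\<bar>f p\<bar> \<noteq> \<infinity>"
    and sub: "\<And>y. f p + ereal (inner (y - p) (z - p)) \<le> f y"
  shows "prox f z = p"
proof -
  obtain c where c: "f p = ereal c"
    using fp by (cases "f p") auto
  have growth: "ereal (c + 1 / 2 * (norm (z - p))\<^sup>2 + 1 / 2 * (norm (y - p))\<^sup>2)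
      \<le> f y + ereal (1 / 2 * (norm (z - y))\<^sup>2)" for y
  proof -
    have "(norm (z - y))\<^sup>2 = (norm (z - p))\<^sup>2 - 2 * inner (y - p) (z - p) + (norm (y - p))\<^sup>2"
      by (simp add: power2_norm_eq_inner algebra_simps inner_commute)
    then have "ereal (c + 1 / 2 * (norm (z - p))\<^sup>2 + 1 / 2 * (norm (y - p))\<^sup>2)
        = (f p + ereal (inner (y - p) (z - p))) + ereal (1 / 2 * (norm (z - y))\<^sup>2)"
      by (simp add: c algebra_simps)
    also have "\<dots> \<le> f y + ereal (1 / 2 * (norm (z - y))\<^sup>2)"
      by (intro add_right_mono sub)
    finally show ?thesis .
  qed
  show ?thesis
    unfolding prox_def is_arg_min_def
  proof (rule the_equality)
    show "True \<and> \<not> (\<exists>y. True \<and> f y + ereal (1 / 2 * (norm (z - y))\<^sup>2)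
        < f p + ereal (1 / 2 * (norm (z - p))\<^sup>2))"
    proof -
      have "f p + ereal (1 / 2 * (norm (z - p))\<^sup>2) \<le> f y + ereal (1 / 2 * (norm (z - y))\<^sup>2)" for y
        using growth[of y] by (rule order_trans[rotated]) (simp add: c)
      then show ?thesis
        by (simp add: not_less)
    qed
  next
    fix p' assume "True \<and> \<not> (\<exists>y. True \<and> f y + ereal (1 / 2 * (norm (z - y))\<^sup>2)
        < f p' + ereal (1 / 2 * (norm (z - p'))\<^sup>2))"
    then have "f p' + ereal (1 / 2 * (norm (z - p'))\<^sup>2) \<le> f p + ereal (1 / 2 * (norm (z - p))\<^sup>2)"
      by (simp add: not_less)
    with growth[of p'] have "ereal (c + 1 / 2 * (norm (z - p))\<^sup>2 + 1 / 2 * (norm (p' - p))\<^sup>2)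
        \<le> f p + ereal (1 / 2 * (norm (z - p))\<^sup>2)"
      by (rule order_trans)
    then show "p' = p"
      by (simp add: c)
  qed
qed

section \<open>Positive roots of the polynomial equation\<close>

text \<open>The polynomial equation of the theorem, divided by \<open>\<gamma>\<close>, with \<open>r = \<parallel>x\<parallel> / \<gamma>\<close>
  and \<open>b = q\<^sup>* (\<alpha> - \<sigma> / \<gamma>)\<close>. On \<open>b < t\<^sup>a\<close> the left side increases and the right side decreases.\<close>

lemma root_bounds:
  fixes a b r t :: real
  assumes "a > 1" "b < r powr a" "r > 0" "t > 0"
    and eq: "t powr (a - 1) * (t powr a - b) = a * (r - t)"
  shows "t < r" and "b < t powr a"
proof -
  show "t < r"
  proof (rule ccontr)
    assume "\<not> t < r"
    then have "r powr a \<le> t powr a"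
      using assms by (intro powr_mono2) auto
    then have "0 < t powr (a - 1) * (t powr a - b)"
      using assms(2,4) by (intro mult_pos_pos) auto
    moreover have "a * (r - t) \<le> 0"
      using \<open>\<not> t < r\<close> \<open>a > 1\<close> by (simp add: mult_nonneg_nonpos)
    ultimately show False
      using eq by simp
  qed
  then have "0 < t powr (a - 1) * (t powr a - b)"
    using eq \<open>a > 1\<close> by simp
  then show "b < t powr a"
    using \<open>t > 0\<close> by (simp add: zero_less_mult_iff)
qed

text \<open>Both factors increase strictly; the bound on \<open>b\<close> keeps the second one
  nonnegative at \<open>s\<close>, so the product increases too.\<close>

lemma powr_mult_strict_mono:
  fixes a b s t :: real
  assumes "a > 1" "0 < s" "s < t" "b \<le> s powr a"
  shows "s powr (a - 1) * (s powr a - b) < t powr (a - 1) * (t powr a - b)"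
proof -
  have "s powr (a - 1) < t powr (a - 1)" "s powr a < t powr a"
    using assms by (auto intro: powr_less_mono2)
  then show ?thesis
    using assms by (intro mult_strict_mono') auto
qed

text \<open>Existence is the intermediate value theorem on \<open>{0..r}\<close>. Every positive
  root satisfies \<open>b < t powr a\<close> by \<open>root_bounds\<close>, and there an increasing
  side meets a decreasing one, so two roots cannot differ.\<close>

lemma root_ex1:
  fixes a b r :: real
  assumes a: "a > 1" and b: "b < r powr a" and r: "r > 0"
  shows "\<exists>!t. t > 0 \<and> t powr (a - 1) * (t powr a - b) = a * (r - t)"
proof -
  let ?F = "\<lambda>t. t powr (a - 1) * (t powr a - b) - a * (r - t)"
  have "\<exists>t\<ge>0. t \<le> r \<and> ?F t = 0"
  proof (rule IVT')
    \<comment> \<open>At 0 the power vanishes because \<open>a > 1\<close>, leaving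
      \<open>- a * r\<close>, which is negative; this also excludes 0 as the zero found. At
      \<open>r\<close> the linear term vanishes and \<open>b < r powr a\<close> gives the
      sign.\<close>
    show "?F 0 \<le> 0" "0 \<le> ?F r"
      using a b r by auto
    show "continuous_on {0..r} ?F"
      using a by (intro continuous_intros continuous_on_powr') auto
  qed (use r in auto)
  then obtain t where t: "0 \<le> t" "?F t = 0"
    by auto
  have "t \<noteq> 0"
    using t(2) a r by (cases "t = 0") auto
  with t have ex: "t > 0 \<and> t powr (a - 1) * (t powr a - b) = a * (r - t)"
    by simp
  have not_less: "\<not> s < u"
    if s: "s > 0" "s powr (a - 1) * (s powr a - b) = a * (r - s)"
      and u: "u > 0" "u powr (a - 1) * (u powr a - b) = a * (r - u)" for s u
  proof
    assume "s < u"
    have "b < s powr a"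
      using root_bounds(2)[OF a b r s] .
    then have "a * (r - s) < a * (r - u)"
      using powr_mult_strict_mono[OF a s(1) \<open>s < u\<close>, of b] s u by simp
    with \<open>s < u\<close> a show False
      by simp
  qed
  show ?thesis
    using ex not_less by (metis linorder_less_linear)
qed

text \<open>If \<open>\<rho> < t\<close>, then \<open>\<rho> < r\<close>, so \<open>le\<close>
  forces \<open>b < \<rho> powr a\<close>. From \<open>\<rho>\<close> to \<open>t\<close> the left
  side then increases while the right side decreases, so the left side would exceed the right one at
  \<open>t\<close>.\<close>

lemma root_le:
  fixes a b r t \<rho> :: real
  assumes "a > 1" "b < r powr a" "r > 0" "t > 0" "\<rho> > 0"
    and eq: "t powr (a - 1) * (t powr a - b) = a * (r - t)"
    and le: "a * (r - \<rho>) \<le> \<rho> powr (a - 1) * (\<rho> powr a - b)"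
  shows "t \<le> \<rho>"
proof (rule ccontr)
  assume "\<not> t \<le> \<rho>"
  then have "\<rho> < t" by simp
  then have "0 < a * (r - \<rho>)"
    using root_bounds(1)[OF assms(1-4) eq] \<open>a > 1\<close> by simp
  then have "0 < \<rho> powr (a - 1) * (\<rho> powr a - b)"
    using le by simp
  then have "b < \<rho> powr a"
    using \<open>\<rho> > 0\<close> by (simp add: zero_less_mult_iff)
  then have "a * (r - \<rho>) < a * (r - t)"
    using powr_mult_strict_mono[OF \<open>a > 1\<close> \<open>\<rho> > 0\<close> \<open>\<rho> < t\<close>, of b] eq le by simp
  with \<open>\<rho> < t\<close> \<open>a > 1\<close> show False
    by simp
qed

section \<open>The generalized Huber function and its subgradients\<close>

text \<open>For \<open>q = 2\<close> this is the Huber function shifted by \<alpha>. The threshold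
  \<open>\<rho> powr (qs / q)\<close> is the radius at which the slope \<open>r powr (q - 1)\<close>
  of the inner branch reaches \<rho>; from there on the function continues with constant radial
  slope.\<close>

locale generalized_huber =
  fixes \<alpha> \<rho> q qs :: real
    and \<phi> :: "'a::real_inner \<Rightarrow> real"
  assumes rho_pos: "\<rho> > 0" and q_gt_1: "q > 1"
    and qs_eq: "qs = q / (q - 1)"
    and phi_eq: "\<phi> y = (if norm y > \<rho> powr (qs / q)
                   then \<alpha> - \<rho> powr qs / qs + \<rho> * norm y
                   else \<alpha> + norm y powr q / q)"
begin

lemma qs_gt_1: "qs > 1"
  using q_gt_1 by (simp add: qs_eq field_simps)

lemma conj_exponents: "qs / q = qs - 1" "(qs - 1) * q = qs" "(q - 1) * (qs - 1) = 1"
  "1 / q + 1 / qs = 1"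
  using q_gt_1 by (auto simp: qs_eq field_simps)

lemma phi_alt: "\<phi> y = (if norm y > \<rho> powr (qs - 1)
    then \<alpha> - \<rho> powr qs / qs + \<rho> * norm y else \<alpha> + norm y powr q / q)"
  by (simp add: phi_eq conj_exponents)

lemma powr_qs: "\<tau> * \<tau> powr (qs - 1) = \<tau> powr qs" if "\<tau> \<ge> 0"
  using that by (simp add: powr_mult_base)

text \<open>Together with \<open>powr_qs\<close> this is equality in Young's inequality for the pair
  \<open>\<tau>\<close>, \<open>\<tau> powr (qs - 1)\<close>, since
  \<open>(qs - 1) * q = qs\<close>.\<close>

lemma powr_div_q: "\<tau> powr qs / q = \<tau> powr qs - \<tau> powr qs / qs"
proof -
  have "\<tau> powr qs / q + \<tau> powr qs / qs = \<tau> powr qs * (1 / q + 1 / qs)"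
    by (simp add: algebra_simps)
  then show ?thesis
    by (simp add: conj_exponents)
qed

lemma young:
  assumes "0 \<le> r" "0 \<le> \<tau>"
  shows "\<tau> * r \<le> r powr q / q + \<tau> powr qs / qs"
proof (cases "r = 0 \<or> \<tau> = 0")
  case True
  then show ?thesis
    using q_gt_1 qs_gt_1 by auto
next
  case False
  then show ?thesis
    using assms Youngs_inequality[of q qs r \<tau>] q_gt_1 qs_gt_1 conj_exponents
    by (simp add: mult.commute)
qed

text \<open>This is the Fenchel-Young inequality on the ball of radius \<rho>. In the inner branch
  it reduces to Cauchy-Schwarz and Young's inequality.\<close>

lemma phi_ge:
  assumes "norm u \<le> \<rho>"
  shows "\<alpha> - norm u powr qs / qs + inner v u \<le> \<phi> v"
proof -
  have "inner v u \<le> norm u * norm v"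
    using norm_cauchy_schwarz[of v u] by (simp add: mult.commute)
  moreover have "\<alpha> - norm u powr qs / qs + norm u * norm v \<le> \<phi> v"
  proof (cases "norm v > \<rho> powr (qs - 1)")
    case True
    \<comment> \<open>In the outer branch Young's inequality is applied at the threshold radius, not
      at \<open>norm v\<close>. Beyond it the left side grows with slope \<open>norm u\<close>,
      which is at most the slope \<rho> of \<open>\<phi>\<close>.\<close>
    let ?r = "\<rho> powr (qs - 1)"
    have "norm u * ?r \<le> ?r powr q / q + norm u powr qs / qs"
      by (rule young) auto
    moreover have "?r powr q / q = \<rho> * ?r - \<rho> powr qs / qs"
      using rho_pos by (simp add: powr_powr conj_exponents powr_qs powr_div_q)
    moreover have "0 \<le> (\<rho> - norm u) * (norm v - ?r)"
      using True assms by simp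
    ultimately show ?thesis
      using True by (simp add: phi_alt algebra_simps)
  next
    case False
    then show ?thesis
      using young[of "norm v" "norm u"] by (simp add: phi_alt)
  qed
  ultimately show ?thesis
    by simp
qed

text \<open>The equality case of the previous lemma, i.e. \<open>u\<close> is a subgradient of \<open>\<phi>\<close> at \<open>v\<close>.\<close>

lemma phi_eq_inner:
  assumes u: "norm u \<le> \<rho>" and uv: "inner v u = norm v * norm u"
    and v: "norm v = norm u powr (qs - 1) \<or> norm u = \<rho> \<and> \<rho> powr (qs - 1) \<le> norm v"
  shows "\<phi> v = \<alpha> - norm u powr qs / qs + inner v u"
proof (cases "norm v > \<rho> powr (qs - 1)")
  case True
  \<comment> \<open>Beyond the threshold the first alternative for \<open>v\<close> is impossible,
    so the second one holds.\<close>
  have "norm u powr (qs - 1) \<le> \<rho> powr (qs - 1)"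
    using u qs_gt_1 by (intro powr_mono2) auto
  with True v have "norm u = \<rho>"
    by auto
  with True show ?thesis
    by (simp add: phi_alt uv)
next
  case False
  \<comment> \<open>Up to the threshold the second alternative is possible only at the threshold
    itself, where it gives the same equation as the first.\<close>
  then have "norm v = norm u powr (qs - 1)"
    using v by auto
  moreover from this have "norm v powr q / q = norm u powr qs - norm u powr qs / qs"
    by (simp add: powr_powr conj_exponents powr_div_q)
  ultimately show ?thesis
    using False by (simp add: phi_alt uv powr_qs mult.commute)
qed

text \<open>The witness is the gradient direction: \<open>v\<close> rescaled to norm \<rho> in the
  outer branch and to norm \<open>norm v powr (q - 1)\<close> in the inner one. The latter norm is
  at most \<rho> because \<open>(q - 1) * (qs - 1) = 1\<close>. At \<open>v = 0\<close> the division
  convention gives \<open>u = 0\<close>.\<close>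

lemma subgradient_ex:
  obtains u where "norm u \<le> \<rho>" "\<phi> v = \<alpha> - norm u powr qs / qs + inner v u"
proof (cases "norm v > \<rho> powr (qs - 1)")
  case True
  then have "v \<noteq> 0"
    by auto
  let ?u = "(\<rho> / norm v) *\<^sub>R v"
  have "norm ?u = \<rho>"
    using \<open>v \<noteq> 0\<close> rho_pos by simp
  moreover from this have "inner v ?u = norm v * norm ?u"
    using \<open>v \<noteq> 0\<close> by (simp add: dot_square_norm power2_eq_square)
  ultimately show thesis
    using True by (intro that[of ?u] phi_eq_inner) auto
next
  case False
  let ?u = "(norm v powr (q - 1) / norm v) *\<^sub>R v"
  have norm_u: "norm ?u = norm v powr (q - 1)"
    by (cases "v = 0") auto
  have "norm v powr (q - 1) \<le> (\<rho> powr (qs - 1)) powr (q - 1)"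
    using False q_gt_1 by (intro powr_mono2) auto
  also have "\<dots> = \<rho>"
    using conj_exponents(3) rho_pos by (simp add: powr_powr mult.commute)
  finally have "norm ?u \<le> \<rho>"
    by (simp only: norm_u)
  moreover have "inner v ?u = norm v * norm ?u"
    unfolding norm_u by (cases "v = 0") (auto simp: dot_square_norm power2_eq_square)
  moreover have "norm v = norm ?u powr (qs - 1)"
    unfolding norm_u by (simp add: powr_powr conj_exponents)
  ultimately show thesis
    by (intro that[of ?u] phi_eq_inner) auto
qed

section \<open>Recession function, perspective and its linear minorants\<close>

text \<open>A subgradient at \<open>x + y\<close> has norm at most \<rho> and bounds the increment
  from above. The bound is attained where \<open>y\<close> and \<open>x + y\<close> both lie in the
  outer branch on the ray through \<open>x\<close>.\<close>

lemma recession_phi: "recession (\<lambda>y. ereal (\<phi> y)) x = ereal (\<rho> * norm x)"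
  unfolding recession_def
proof (rule antisym)
  show "(SUP y\<in>edom (\<lambda>y. ereal (\<phi> y)). ereal (\<phi> (x + y)) - ereal (\<phi> y)) \<le> ereal (\<rho> * norm x)"
  proof (rule SUP_least)
    fix y
    obtain u where u: "norm u \<le> \<rho>" "\<phi> (x + y) = \<alpha> - norm u powr qs / qs + inner (x + y) u"
      using subgradient_ex .
    then have "\<phi> (x + y) - \<phi> y \<le> inner x u"
      using phi_ge[OF u(1), of y] by (simp add: inner_add_left)
    also have "\<dots> \<le> norm x * norm u"
      by (rule norm_cauchy_schwarz)
    also have "\<dots> \<le> \<rho> * norm x"
      using u(1) by (simp add: mult.commute mult_right_mono)
    finally show "ereal (\<phi> (x + y)) - ereal (\<phi> y) \<le> ereal (\<rho> * norm x)"
      by simp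
  qed
next
  show "ereal (\<rho> * norm x) \<le> (SUP y\<in>edom (\<lambda>y. ereal (\<phi> y)). ereal (\<phi> (x + y)) - ereal (\<phi> y))"
  proof (cases "x = 0")
    case True
    then show ?thesis
      by (auto intro!: SUP_upper2[of 0] simp: edom_def)
  next
    case False
    \<comment> \<open>The multiple is chosen so that \<open>c *\<^sub>R x\<close> lies beyond the
      threshold by exactly \<open>norm x\<close>.\<close>
    define c where "c = \<rho> powr (qs - 1) / norm x + 1"
    have "c > 0"
      unfolding c_def by (rule add_nonneg_pos) auto
    have n1: "norm (c *\<^sub>R x) = \<rho> powr (qs - 1) + norm x"
      using False \<open>c > 0\<close> by (simp add: c_def field_simps)
    have "x + c *\<^sub>R x = (c + 1) *\<^sub>R x"
      by (simp add: scaleR_add_left)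
    then have n2: "norm (x + c *\<^sub>R x) = \<rho> powr (qs - 1) + norm x + norm x"
      using \<open>c > 0\<close> n1 by (simp add: distrib_right)
    have "\<phi> (x + c *\<^sub>R x) - \<phi> (c *\<^sub>R x) = \<rho> * norm x"
      unfolding phi_alt n1 n2 using False by (simp add: algebra_simps)
    then show ?thesis
      by (auto intro!: SUP_upper2[of "c *\<^sub>R x"] simp: edom_def)
  qed
qed

lemma perspective_phi:
  "perspective (\<lambda>y. ereal (\<phi> y)) (\<sigma>, x) =
    (if \<sigma> > 0 \<and> norm x > \<sigma> * \<rho> powr (qs / q)
       then ereal ((\<alpha> - \<rho> powr qs / qs) * \<sigma> + \<rho> * norm x)
     else if \<sigma> > 0 \<and> norm x \<le> \<sigma> * \<rho> powr (qs / q)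
       then ereal (\<alpha> * \<sigma> + norm x powr q / (q * \<sigma> powr (q - 1)))
     else if \<sigma> = 0 then ereal (\<rho> * norm x)
     else \<infinity>)"
proof (cases "\<sigma> > 0")
  case True
  have n: "norm (x /\<^sub>R \<sigma>) = norm x / \<sigma>"
    using True by (simp add: divide_inverse mult.commute)
  have "\<sigma> * ((norm x / \<sigma>) powr q) = norm x powr q / \<sigma> powr (q - 1)"
    using True by (simp add: powr_divide powr_diff)
  then have "\<sigma> * (\<alpha> + (norm x / \<sigma>) powr q / q) = \<alpha> * \<sigma> + norm x powr q / (q * \<sigma> powr (q - 1))"
    by (simp add: algebra_simps)
  then have "\<sigma> * \<phi> (x /\<^sub>R \<sigma>) = (if norm x > \<sigma> * \<rho> powr (qs / q)
      then (\<alpha> - \<rho> powr qs / qs) * \<sigma> + \<rho> * norm x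
      else \<alpha> * \<sigma> + norm x powr q / (q * \<sigma> powr (q - 1)))"
    unfolding phi_eq n using True by (auto simp: field_simps)
  then show ?thesis
    using True by (simp add: perspective_def)
qed (simp add: perspective_def recession_phi)

text \<open>Each (\<mu>, u) in the set C defines a linear minorant: for a positive first coordinate
  this is \<open>phi_ge\<close> rescaled, for a zero one it is Cauchy-Schwarz against the recession
  function.\<close>

lemma perspective_ge:
  assumes u: "norm u \<le> \<rho>" and \<mu>: "\<mu> + norm u powr qs / qs \<le> \<alpha>"
  shows "ereal (inner y (\<mu>, u)) \<le> perspective (\<lambda>y. ereal (\<phi> y)) y"
proof -
  obtain s v where y: "y = (s, v)"
    by fastforce
  consider "s > 0" | "s = 0" | "s < 0"
    by linarith
  then show ?thesis
  proof cases
    case 1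
    have "\<mu> + inner (v /\<^sub>R s) u \<le> \<phi> (v /\<^sub>R s)"
      using phi_ge[OF u, of "v /\<^sub>R s"] \<mu> by linarith
    then have "s * (\<mu> + inner (v /\<^sub>R s) u) \<le> s * \<phi> (v /\<^sub>R s)"
      using 1 by (intro mult_left_mono) auto
    moreover have "s * (\<mu> + inner (v /\<^sub>R s) u) = s * \<mu> + inner v u"
      using 1 by (simp add: field_simps)
    ultimately have "s * \<mu> + inner v u \<le> s * \<phi> (v /\<^sub>R s)"
      by (simp only:)
    then show ?thesis
      using 1 by (simp add: perspective_def y)
  next
    case 2
    have "inner v u \<le> norm v * norm u"
      by (rule norm_cauchy_schwarz)
    also have "\<dots> \<le> \<rho> * norm v"
      using u by (simp add: mult.commute mult_right_mono)
    finally show ?thesis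
      using 2 by (simp add: perspective_def recession_phi y)
  next
    case 3
    then show ?thesis
      by (simp add: perspective_def y)
  qed
qed

section \<open>Proximal points of the perspective\<close>

text \<open>The minorant given by (\<mu>, u) touches the perspective at \<open>p\<close>, so after
  scaling by \<gamma> the vector \<open>z - p\<close> is a subgradient at \<open>p\<close>, as
  \<open>prox_eqI\<close> requires.\<close>

lemma prox_perspective_eqI:
  assumes "\<gamma> > 0" and "norm u \<le> \<rho>" and "\<mu> + norm u powr qs / qs \<le> \<alpha>"
    and z: "z = p + \<gamma> *\<^sub>R (\<mu>, u)"
    and p: "perspective (\<lambda>y. ereal (\<phi> y)) p = ereal (inner p (\<mu>, u))"
  shows "prox (\<lambda>z. ereal \<gamma> * perspective (\<lambda>y. ereal (\<phi> y)) z) z = p"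
proof (rule prox_eqI)
  show "\<bar>ereal \<gamma> * perspective (\<lambda>y. ereal (\<phi> y)) p\<bar> \<noteq> \<infinity>"
    by (simp add: p)
  fix y
  have "ereal \<gamma> * ereal (inner y (\<mu>, u)) \<le> ereal \<gamma> * perspective (\<lambda>y. ereal (\<phi> y)) y"
    using perspective_ge[OF assms(2,3)] \<open>\<gamma> > 0\<close> by (intro ereal_mult_left_mono) auto
  moreover have "ereal \<gamma> * perspective (\<lambda>y. ereal (\<phi> y)) p + ereal (inner (y - p) (z - p))
      = ereal \<gamma> * ereal (inner y (\<mu>, u))"
    unfolding p z by (simp add: inner_diff_left algebra_simps del: scaleR_Pair)
  ultimately show "ereal \<gamma> * perspective (\<lambda>y. ereal (\<phi> y)) p + ereal (inner (y - p) (z - p))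
      \<le> ereal \<gamma> * perspective (\<lambda>y. ereal (\<phi> y)) y"
    by simp
qed

text \<open>When the first coordinate of the proximal point is positive, \<mu> is taken as large as
  C allows, namely \<open>\<alpha> - norm u powr qs / qs\<close>. The conditions on \<open>v\<close>
  are the equality case \<open>phi_eq_inner\<close> at \<open>v /\<^sub>R s\<close>, multiplied by
  \<open>s\<close>.\<close>

lemma prox_perspective_pos:
  assumes "\<gamma> > 0" and s: "s > 0" and u: "norm u \<le> \<rho>"
    and vu: "inner v u = norm v * norm u"
    and v: "norm v = s * norm u powr (qs - 1) \<or> norm u = \<rho> \<and> s * \<rho> powr (qs - 1) \<le> norm v"
    and \<sigma>: "\<sigma> = s + \<gamma> * (\<alpha> - norm u powr qs / qs)" and x: "x = v + \<gamma> *\<^sub>R u"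
  shows "prox (\<lambda>z. ereal \<gamma> * perspective (\<lambda>y. ereal (\<phi> y)) z) (\<sigma>, x) = (s, v)"
proof (rule prox_perspective_eqI[OF \<open>\<gamma> > 0\<close> u])
  let ?\<mu> = "\<alpha> - norm u powr qs / qs"
  show "?\<mu> + norm u powr qs / qs \<le> \<alpha>" "(\<sigma>, x) = (s, v) + \<gamma> *\<^sub>R (?\<mu>, u)"
    by (simp_all add: \<sigma> x)
  have n: "norm (v /\<^sub>R s) = norm v / s"
    using s by (simp add: divide_inverse mult.commute)
  have "\<phi> (v /\<^sub>R s) = ?\<mu> + inner (v /\<^sub>R s) u"
  proof (rule phi_eq_inner[OF u])
    show "inner (v /\<^sub>R s) u = norm (v /\<^sub>R s) * norm u"
      unfolding n using vu by (simp add: divide_inverse)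
    show "norm (v /\<^sub>R s) = norm u powr (qs - 1) \<or> norm u = \<rho> \<and> \<rho> powr (qs - 1) \<le> norm (v /\<^sub>R s)"
      unfolding n using v s by (auto simp: field_simps)
  qed
  then have "s * \<phi> (v /\<^sub>R s) = s * ?\<mu> + inner v u"
    using s by (simp add: field_simps)
  then show "perspective (\<lambda>y. ereal (\<phi> y)) (s, v) = ereal (inner (s, v) (?\<mu>, u))"
    using s by (simp add: perspective_def)
qed

text \<open>The two bounds say that (\<sigma>, x) divided by \<gamma> lies in C, and the perspective
  vanishes at the origin.\<close>

lemma prox_perspective_zero:
  assumes "\<gamma> > 0" and "norm x \<le> \<gamma> * \<rho>"
    and le: "norm x powr qs \<le> \<gamma> powr qs * qs * (\<alpha> - \<sigma> / \<gamma>)"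
  shows "prox (\<lambda>z. ereal \<gamma> * perspective (\<lambda>y. ereal (\<phi> y)) z) (\<sigma>, x) = (0, 0)"
proof (rule prox_perspective_eqI[OF \<open>\<gamma> > 0\<close>])
  have n: "norm (x /\<^sub>R \<gamma>) = norm x / \<gamma>"
    using \<open>\<gamma> > 0\<close> by (simp add: divide_inverse mult.commute)
  show "norm (x /\<^sub>R \<gamma>) \<le> \<rho>"
    unfolding n using assms by (simp add: field_simps)
  have "norm x powr qs / \<gamma> powr qs \<le> qs * (\<alpha> - \<sigma> / \<gamma>)"
    using le \<open>\<gamma> > 0\<close> by (subst pos_divide_le_eq) (auto simp: mult_ac)
  then show "\<sigma> / \<gamma> + norm (x /\<^sub>R \<gamma>) powr qs / qs \<le> \<alpha>"
    unfolding n using \<open>\<gamma> > 0\<close> qs_gt_1 by (simp add: powr_divide field_simps)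
  show "(\<sigma>, x) = (0, 0) + \<gamma> *\<^sub>R (\<sigma> / \<gamma>, x /\<^sub>R \<gamma>)"
    using \<open>\<gamma> > 0\<close> by simp
  show "perspective (\<lambda>y. ereal (\<phi> y)) (0, 0) = ereal (inner (0, 0) (\<sigma> / \<gamma>, x /\<^sub>R \<gamma>))"
    by (simp add: perspective_def recession_phi zero_ereal_def)
qed

text \<open>Here \<mu> is \<open>\<sigma> / \<gamma>\<close> and \<open>u\<close> is
  \<open>x\<close> rescaled to norm \<rho>. Since \<open>norm x > \<gamma> * \<rho>\<close>, the
  second coordinate of the proximal point is a positive multiple of \<open>x\<close>, so its inner
  product with \<open>u\<close> equals the recession function there.\<close>

lemma prox_perspective_boundary:
  assumes "\<gamma> > 0" and \<sigma>: "\<sigma> \<le> \<gamma> * (\<alpha> - \<rho> powr qs / qs)" and x: "norm x > \<gamma> * \<rho>"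
  shows "prox (\<lambda>z. ereal \<gamma> * perspective (\<lambda>y. ereal (\<phi> y)) z) (\<sigma>, x) =
    (0, (1 - \<gamma> * \<rho> / norm x) *\<^sub>R x)"
proof (rule prox_perspective_eqI[OF \<open>\<gamma> > 0\<close>])
  let ?u = "(\<rho> / norm x) *\<^sub>R x"
  have x0: "norm x > 0"
    using x \<open>\<gamma> > 0\<close> rho_pos by (meson less_trans mult_pos_pos)
  then have n: "norm ?u = \<rho>"
    using rho_pos by simp
  then show "norm ?u \<le> \<rho>"
    by simp
  have "\<sigma> / \<gamma> \<le> \<alpha> - \<rho> powr qs / qs"
    using \<sigma> \<open>\<gamma> > 0\<close> by (simp only: pos_divide_le_eq mult.commute)
  then show "\<sigma> / \<gamma> + norm ?u powr qs / qs \<le> \<alpha>"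
    unfolding n by simp
  show "(\<sigma>, x) = (0, (1 - \<gamma> * \<rho> / norm x) *\<^sub>R x) + \<gamma> *\<^sub>R (\<sigma> / \<gamma>, ?u)"
    using \<open>\<gamma> > 0\<close> by (simp add: scaleR_diff_left)
  have "0 \<le> 1 - \<gamma> * \<rho> / norm x"
    using x x0 by simp
  then have "\<rho> * norm ((1 - \<gamma> * \<rho> / norm x) *\<^sub>R x) = inner ((1 - \<gamma> * \<rho> / norm x) *\<^sub>R x) ?u"
    using x0 by (simp add: dot_square_norm power2_eq_square)
  then show "perspective (\<lambda>y. ereal (\<phi> y)) (0, (1 - \<gamma> * \<rho> / norm x) *\<^sub>R x) =
      ereal (inner (0, (1 - \<gamma> * \<rho> / norm x) *\<^sub>R x) (\<sigma> / \<gamma>, ?u))"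
    by (simp add: perspective_def recession_phi)
qed

text \<open>Again \<open>u\<close> is \<open>x\<close> rescaled to norm \<rho>; the lower bound on
  \<open>norm x\<close> places \<open>?v /\<^sub>R ?s\<close> at or beyond the threshold.\<close>

lemma prox_perspective_linear:
  assumes "\<gamma> > 0" and \<sigma>: "\<sigma> > \<gamma> * (\<alpha> - \<rho> powr qs / qs)"
    and x: "norm x \<ge> \<gamma> * \<rho> powr (qs - 1) * (\<sigma> / \<gamma> + \<rho> powr (2 - qs) + \<rho> powr qs / qs - \<alpha>)"
  shows "prox (\<lambda>z. ereal \<gamma> * perspective (\<lambda>y. ereal (\<phi> y)) z) (\<sigma>, x) =
    (\<sigma> + \<gamma> * (\<rho> powr qs / qs - \<alpha>), (1 - \<gamma> * \<rho> / norm x) *\<^sub>R x)"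
proof -
  let ?s = "\<sigma> + \<gamma> * (\<rho> powr qs / qs - \<alpha>)" and ?u = "(\<rho> / norm x) *\<^sub>R x"
    and ?v = "(1 - \<gamma> * \<rho> / norm x) *\<^sub>R x"
  have s: "?s > 0"
    using \<sigma> by (simp add: algebra_simps)
  \<comment> \<open>With this product the bound on \<open>norm x\<close> becomes
    \<open>?s * \<rho> powr (qs - 1) + \<gamma> * \<rho> \<le> norm x\<close>.\<close>
  have "\<rho> powr (qs - 1) * \<rho> powr (2 - qs) = \<rho>"
    using rho_pos by (simp flip: powr_add)
  then have "\<gamma> * \<rho> powr (qs - 1) * (\<sigma> / \<gamma> + \<rho> powr (2 - qs) + \<rho> powr qs / qs - \<alpha>)
      = ?s * \<rho> powr (qs - 1) + \<gamma> * \<rho>"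
    using \<open>\<gamma> > 0\<close> by (simp add: algebra_simps)
  with x have x': "?s * \<rho> powr (qs - 1) \<le> norm x - \<gamma> * \<rho>"
    by simp
  moreover have "?s * \<rho> powr (qs - 1) > 0"
    using s rho_pos by simp
  ultimately have gt: "norm x > \<gamma> * \<rho>"
    by linarith
  then have x0: "norm x > 0"
    using \<open>\<gamma> > 0\<close> rho_pos by (meson less_trans mult_pos_pos)
  have nu: "norm ?u = \<rho>"
    using x0 rho_pos by simp
  have nonneg: "0 \<le> 1 - \<gamma> * \<rho> / norm x"
    using gt x0 by simp
  then have nv: "norm ?v = norm x - \<gamma> * \<rho>"
    using x0 by (simp add: field_simps)
  show ?thesis
  proof (rule prox_perspective_pos[OF \<open>\<gamma> > 0\<close> s, where u = ?u])
    show "norm ?u \<le> \<rho>"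
      by (simp only: nu)
    show "inner ?v ?u = norm ?v * norm ?u"
      unfolding nu nv using x0 by (simp add: dot_square_norm power2_eq_square field_simps)
    show "norm ?v = ?s * norm ?u powr (qs - 1) \<or> norm ?u = \<rho> \<and> ?s * \<rho> powr (qs - 1) \<le> norm ?v"
      unfolding nu nv using x' by simp
    show "\<sigma> = ?s + \<gamma> * (\<alpha> - norm ?u powr qs / qs)"
      unfolding nu by (simp add: algebra_simps)
    show "x = ?v + \<gamma> *\<^sub>R ?u"
      by (simp add: scaleR_diff_left)
  qed
qed

lemma root_equation_iff:
  assumes "\<gamma> > 0" "t > 0"
  shows "\<gamma> * t powr (2 * qs - 1) + qs * (\<sigma> - \<gamma> * \<alpha>) * t powr (qs - 1) + \<gamma> * qs * t - qs * c = 0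
    \<longleftrightarrow> t powr (qs - 1) * (t powr qs - qs * (\<alpha> - \<sigma> / \<gamma>)) = qs * (c / \<gamma> - t)"
proof -
  have "t powr (2 * qs - 1) = t powr (qs - 1) * t powr qs"
    by (simp flip: powr_add)
  then have "\<gamma> * t powr (2 * qs - 1) + qs * (\<sigma> - \<gamma> * \<alpha>) * t powr (qs - 1) + \<gamma> * qs * t - qs * c
    = \<gamma> * (t powr (qs - 1) * (t powr qs - qs * (\<alpha> - \<sigma> / \<gamma>)) - qs * (c / \<gamma> - t))"
    using assms by (simp add: field_simps)
  then show ?thesis
    using assms by simp
qed

text \<open>The dual vector \<open>u\<close> is \<open>x\<close> rescaled to norm \<open>t\<close>.
  The root bounds give \<open>?s > 0\<close> and make \<open>?v\<close> a nonnegative multiple of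
  \<open>x\<close>; the upper bound on \<open>norm x\<close> gives
  \<open>t \<le> \<rho>\<close>.\<close>

lemma prox_perspective_interior:
  assumes "\<gamma> > 0"
    and b: "qs * (\<alpha> - \<sigma> / \<gamma>) < (norm x / \<gamma>) powr qs"
    and x: "norm x < \<gamma> * \<rho> powr (qs - 1) * (\<sigma> / \<gamma> + \<rho> powr (2 - qs) + \<rho> powr qs / qs - \<alpha>)"
    and "x \<noteq> 0" "t > 0"
    and eq: "t powr (qs - 1) * (t powr qs - qs * (\<alpha> - \<sigma> / \<gamma>)) = qs * (norm x / \<gamma> - t)"
  shows "prox (\<lambda>z. ereal \<gamma> * perspective (\<lambda>y. ereal (\<phi> y)) z) (\<sigma>, x) =
    (\<sigma> + \<gamma> * (t powr qs / qs - \<alpha>), x - \<gamma> *\<^sub>R (t / norm x) *\<^sub>R x)"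
proof -
  let ?b = "qs * (\<alpha> - \<sigma> / \<gamma>)" and ?r = "norm x / \<gamma>"
  let ?s = "\<sigma> + \<gamma> * (t powr qs / qs - \<alpha>)" and ?u = "(t / norm x) *\<^sub>R x"
  let ?v = "x - \<gamma> *\<^sub>R ?u"
  have r: "?r > 0"
    using \<open>x \<noteq> 0\<close> \<open>\<gamma> > 0\<close> by simp
  have "t < ?r" and bt: "?b < t powr qs"
    using root_bounds[OF qs_gt_1 b r \<open>t > 0\<close> eq] .
  have qs0: "qs > 0"
    using qs_gt_1 by simp
  have s_eq: "?s = \<gamma> * (t powr qs - ?b) / qs"
    using qs0 \<open>\<gamma> > 0\<close> by (simp add: field_simps)
  have s: "?s > 0"
    unfolding s_eq using bt qs0 \<open>\<gamma> > 0\<close> by simp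
  have le: "t \<le> \<rho>"
  proof (rule root_le[OF qs_gt_1 b r \<open>t > 0\<close> rho_pos eq])
    \<comment> \<open>The upper bound on \<open>norm x\<close> is rewritten as the comparison at
      \<rho> that \<open>root_le\<close> expects.\<close>
    have "\<rho> powr (qs - 1) * \<rho> powr (2 - qs) = \<rho>"
      using rho_pos by (simp flip: powr_add)
    then have "\<gamma> * \<rho> powr (qs - 1) * (\<sigma> / \<gamma> + \<rho> powr (2 - qs) + \<rho> powr qs / qs - \<alpha>)
        = \<gamma> * (\<rho> powr (qs - 1) * (\<rho> powr qs - ?b) / qs + \<rho>)"
      using \<open>\<gamma> > 0\<close> qs0 by (simp add: field_simps)
    with x have "?r < \<rho> powr (qs - 1) * (\<rho> powr qs - ?b) / qs + \<rho>"
      using \<open>\<gamma> > 0\<close> by (simp add: pos_divide_less_eq mult.commute)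
    then show "qs * (?r - \<rho>) \<le> \<rho> powr (qs - 1) * (\<rho> powr qs - ?b)"
      using qs0 by (simp add: field_simps)
  qed
  have nu: "norm ?u = t"
    using \<open>x \<noteq> 0\<close> \<open>t > 0\<close> by simp
  have v_eq: "?v = (1 - \<gamma> * t / norm x) *\<^sub>R x"
    by (simp add: scaleR_diff_left)
  have "0 \<le> 1 - \<gamma> * t / norm x"
    using \<open>t < ?r\<close> \<open>\<gamma> > 0\<close> \<open>x \<noteq> 0\<close> by (simp add: field_simps)
  then have nv: "norm ?v = norm x - \<gamma> * t"
    unfolding v_eq using \<open>x \<noteq> 0\<close> by (simp add: field_simps)
  show ?thesis
  proof (rule prox_perspective_pos[OF \<open>\<gamma> > 0\<close> s, where u = ?u])
    show "norm ?u \<le> \<rho>"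
      by (simp only: nu le)
    show "inner ?v ?u = norm ?v * norm ?u"
      unfolding nu nv unfolding v_eq
      using \<open>x \<noteq> 0\<close> by (simp add: dot_square_norm power2_eq_square field_simps)
    \<comment> \<open>Read through \<open>s_eq\<close>, the root equation says
      \<open>norm ?v = ?s * t powr (qs - 1)\<close>, the first alternative of the equality
      case.\<close>
    have "norm ?v = \<gamma> * (?r - t)"
      unfolding nv using \<open>\<gamma> > 0\<close> by (simp add: field_simps)
    also have "?r - t = t powr (qs - 1) * (t powr qs - ?b) / qs"
      unfolding eq using qs0 by simp
    finally show "norm ?v = ?s * norm ?u powr (qs - 1)
        \<or> norm ?u = \<rho> \<and> ?s * \<rho> powr (qs - 1) \<le> norm ?v"
      unfolding nu s_eq by (simp add: mult_ac)
    show "\<sigma> = ?s + \<gamma> * (\<alpha> - norm ?u powr qs / qs)"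
      unfolding nu by (simp add: algebra_simps)
  qed simp
qed

end

section \<open>The perspective and the four regimes of its proximity operator\<close>

theorem mainTheorem2:
  fixes \<alpha> \<gamma> \<rho> q qs :: real
    and \<phi> :: "'a::{real_inner, complete_space} \<Rightarrow> real"
    and \<sigma> :: real and x :: 'a
  assumes "\<alpha> > 0" and "\<gamma> > 0" and "\<rho> > 0" and "q > 1"
    and "qs = q / (q - 1)"
    and "\<And>y. \<phi> y = (if norm y > \<rho> powr (qs / q)
                   then \<alpha> - \<rho> powr qs / qs + \<rho> * norm y
                   else \<alpha> + norm y powr q / q)"
  shows
    "perspective (\<lambda>y. ereal (\<phi> y)) (\<sigma>, x) =
      (if \<sigma> > 0 \<and> norm x > \<sigma> * \<rho> powr (qs / q)
         then ereal ((\<alpha> - \<rho> powr qs / qs) * \<sigma> + \<rho> * norm x)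
       else if \<sigma> > 0 \<and> norm x \<le> \<sigma> * \<rho> powr (qs / q)
         then ereal (\<alpha> * \<sigma> + norm x powr q / (q * \<sigma> powr (q - 1)))
       else if \<sigma> = 0 then ereal (\<rho> * norm x)
       else \<infinity>)
   \<and> (norm x \<le> \<gamma> * \<rho> \<and> norm x powr qs \<le> \<gamma> powr qs * qs * (\<alpha> - \<sigma> / \<gamma>) \<longrightarrow>
       prox (\<lambda>z. ereal \<gamma> * perspective (\<lambda>y. ereal (\<phi> y)) z) (\<sigma>, x) = (0, 0))
   \<and> (\<sigma> \<le> \<gamma> * (\<alpha> - \<rho> powr qs / qs) \<and> norm x > \<gamma> * \<rho> \<longrightarrow>
       prox (\<lambda>z. ereal \<gamma> * perspective (\<lambda>y. ereal (\<phi> y)) z) (\<sigma>, x) =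
         (0, (1 - \<gamma> * \<rho> / norm x) *\<^sub>R x))
   \<and> (\<sigma> > \<gamma> * (\<alpha> - \<rho> powr qs / qs) \<and>
      norm x \<ge> \<gamma> * \<rho> powr (qs - 1) * (\<sigma> / \<gamma> + \<rho> powr (2 - qs) + \<rho> powr qs / qs - \<alpha>) \<longrightarrow>
       prox (\<lambda>z. ereal \<gamma> * perspective (\<lambda>y. ereal (\<phi> y)) z) (\<sigma>, x) =
         (\<sigma> + \<gamma> * (\<rho> powr qs / qs - \<alpha>), (1 - \<gamma> * \<rho> / norm x) *\<^sub>R x))
   \<and> (norm x powr qs > qs * \<gamma> powr qs * (\<alpha> - \<sigma> / \<gamma>) \<and>
      norm x < \<gamma> * \<rho> powr (qs - 1) * (\<sigma> / \<gamma> + \<rho> powr (2 - qs) + \<rho> powr qs / qs - \<alpha>) \<longrightarrow>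
       (x \<noteq> 0 \<longrightarrow>
          (\<exists>!t. t > 0 \<and>
             \<gamma> * t powr (2 * qs - 1) + qs * (\<sigma> - \<gamma> * \<alpha>) * t powr (qs - 1)
               + \<gamma> * qs * t - qs * norm x = 0)) \<and>
       (\<forall>t p.
          (x \<noteq> 0 \<longrightarrow>
             t > 0 \<and>
             \<gamma> * t powr (2 * qs - 1) + qs * (\<sigma> - \<gamma> * \<alpha>) * t powr (qs - 1)
               + \<gamma> * qs * t - qs * norm x = 0 \<and>
             p = (t / norm x) *\<^sub>R x) \<and>
          (x = 0 \<longrightarrow> t = 0 \<and> p = 0) \<longrightarrow>
          prox (\<lambda>z. ereal \<gamma> * perspective (\<lambda>y. ereal (\<phi> y)) z) (\<sigma>, x) =
            (if qs * \<gamma> powr (qs - 1) * \<sigma> + norm x powr qs > qs * \<gamma> powr qs * \<alpha>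
             then (\<sigma> + \<gamma> * (t powr qs / qs - \<alpha>), x - \<gamma> *\<^sub>R p)
             else (0, 0))))"
proof -
  interpret generalized_huber \<alpha> \<rho> q qs \<phi>
    using assms by unfold_locales auto
  have le_iff: "qs * \<gamma> powr qs * (\<alpha> - \<sigma> / \<gamma>) < norm x powr qs
      \<longleftrightarrow> qs * (\<alpha> - \<sigma> / \<gamma>) < (norm x / \<gamma>) powr qs"
    using \<open>\<gamma> > 0\<close> by (simp add: powr_divide field_simps)
  \<comment> \<open>Because \<open>\<gamma> powr (qs - 1) * \<sigma>\<close> equals
    \<open>\<gamma> powr qs * (\<sigma> / \<gamma>)\<close>, the test in the conditional restates
    the first hypothesis of the last regime, so its first branch is the value to establish.\<close>
  have if_iff: "qs * \<gamma> powr (qs - 1) * \<sigma> + norm x powr qs > qs * \<gamma> powr qs * \<alpha>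
      \<longleftrightarrow> norm x powr qs > qs * \<gamma> powr qs * (\<alpha> - \<sigma> / \<gamma>)"
    using \<open>\<gamma> > 0\<close> by (simp add: powr_diff algebra_simps)
  have root: "\<exists>!t. t > 0 \<and> \<gamma> * t powr (2 * qs - 1) + qs * (\<sigma> - \<gamma> * \<alpha>) * t powr (qs - 1)
      + \<gamma> * qs * t - qs * norm x = 0"
    if "qs * (\<alpha> - \<sigma> / \<gamma>) < (norm x / \<gamma>) powr qs" "x \<noteq> 0"
  proof -
    have "norm x / \<gamma> > 0"
      using that \<open>\<gamma> > 0\<close> by simp
    from root_ex1[OF qs_gt_1 that(1) this] show ?thesis
      using root_equation_iff[OF \<open>\<gamma> > 0\<close>] by (simp cong: conj_cong)
  qed
  have prox_0: "prox (\<lambda>z. ereal \<gamma> * perspective (\<lambda>y. ereal (\<phi> y)) z) (\<sigma>, x)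
      = (\<sigma> + \<gamma> * (0 powr qs / qs - \<alpha>), x - \<gamma> *\<^sub>R 0)"
    if "qs * (\<alpha> - \<sigma> / \<gamma>) < (norm x / \<gamma>) powr qs" "x = 0"
  proof -
    \<comment> \<open>For \<open>x = 0\<close> the power on the right is 0, so the hypothesis reads
      \<open>\<alpha> < \<sigma> / \<gamma>\<close>. The proximal point is then obtained with
      \<open>u = 0\<close> and \<open>v = 0\<close>.\<close>
    have "\<sigma> - \<gamma> * \<alpha> > 0"
      using that qs_gt_1 \<open>\<gamma> > 0\<close> by (simp add: mult_less_0_iff field_simps)
    then show ?thesis
      using that(2) \<open>\<gamma> > 0\<close> \<open>\<rho> > 0\<close> by (intro prox_perspective_pos[where u = 0]) auto
  qed
  show ?thesis
    unfolding if_iff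
  proof (intro conjI impI allI perspective_phi)
    fix t p
    assume A: "norm x powr qs > qs * \<gamma> powr qs * (\<alpha> - \<sigma> / \<gamma>) \<and>
        norm x < \<gamma> * \<rho> powr (qs - 1) * (\<sigma> / \<gamma> + \<rho> powr (2 - qs) + \<rho> powr qs / qs - \<alpha>)"
      and t: "(x \<noteq> 0 \<longrightarrow> t > 0 \<and>
             \<gamma> * t powr (2 * qs - 1) + qs * (\<sigma> - \<gamma> * \<alpha>) * t powr (qs - 1)
               + \<gamma> * qs * t - qs * norm x = 0 \<and> p = (t / norm x) *\<^sub>R x) \<and>
          (x = 0 \<longrightarrow> t = 0 \<and> p = 0)"
    from A have b: "qs * (\<alpha> - \<sigma> / \<gamma>) < (norm x / \<gamma>) powr qs"
      by (simp add: le_iff)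
    have "prox (\<lambda>z. ereal \<gamma> * perspective (\<lambda>y. ereal (\<phi> y)) z) (\<sigma>, x)
        = (\<sigma> + \<gamma> * (t powr qs / qs - \<alpha>), x - \<gamma> *\<^sub>R p)"
    proof (cases "x = 0")
      case True
      with t prox_0[OF b] show ?thesis
        by simp
    next
      case False
      then have "t > 0" and p: "p = (t / norm x) *\<^sub>R x"
        and "t powr (qs - 1) * (t powr qs - qs * (\<alpha> - \<sigma> / \<gamma>)) = qs * (norm x / \<gamma> - t)"
        using t root_equation_iff[OF \<open>\<gamma> > 0\<close>, of t] by auto
      with A b False show ?thesis
        unfolding p by (intro prox_perspective_interior[OF \<open>\<gamma> > 0\<close>]) auto
    qed
    with A show "prox (\<lambda>z. ereal \<gamma> * perspective (\<lambda>y. ereal (\<phi> y)) z) (\<sigma>, x) =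
        (if norm x powr qs > qs * \<gamma> powr qs * (\<alpha> - \<sigma> / \<gamma>)
         then (\<sigma> + \<gamma> * (t powr qs / qs - \<alpha>), x - \<gamma> *\<^sub>R p) else (0, 0))"
      by simp
  qed (use root le_iff prox_perspective_zero[OF \<open>\<gamma> > 0\<close>] prox_perspective_boundary[OF \<open>\<gamma> > 0\<close>]
      prox_perspective_linear[OF \<open>\<gamma> > 0\<close>] in \<open>blast+\<close>)
qed

end
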